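(* Let $G=(V,E)$ be a graph, let $A\subseteq V$ induce an odd antihole in $G$, and let $k\in V\setminus A$. Then every $X_{A\cup\{k\}}=(X_{ij})_{i,j\in A\cup\{k\}}\in\mathrm{STAB}^2(G_{A\cup\{k\}})$ satisfies $$\sum_{i\in A}X_{ik}\le2X_{kk}$$ and $$\sum_{i\in A}X_{ii}+2X_{kk}\le2+\sum_{i\in A}X_{ik}.$$
   Context: Graphs are finite, simple and undirected. For $I\subseteq V$, $G_I$ is the subgraph of $G$ induced by $I$. A hole is a chordless cycle of length at least four; an odd hole is a hole with an odd number of vertices (hence at least five); an odd antihole is the complement of an odd hole. A set $A$ induces an odd antihole in $G$ if $G_A$ is an odd antihole. For a graph $H$, $\mathcal{S}(H)\subseteq\{0,1\}^{V(H)}$ is the set of incidence vectors of stable sets of $H$ (including the empty set), $\mathcal{S}^2(H)=\{ss^\top : s\in\mathcal{S}(H)\}$, and $\mathrm{STAB}^2(H)=\mathrm{conv}\,\mathcal{S}^2(H)$. *)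

theory Defs
  imports "HOL-Analysis.Analysis" "HOL-Library.Ramsey"
begin

text \<open>A graph is given by its vertex set \<open>V\<close> and its edge set \<open>E\<close>, a set of two-element
  subsets of \<open>V\<close> (\<open>[V]\<^bsup>2\<^esup>\<close> is notation for \<^const>\<open>nsets\<close>).\<close>

definition simple_graph :: "'v set \<Rightarrow> 'v set set \<Rightarrow> bool" where
  "simple_graph V E \<longleftrightarrow> finite V \<and> E \<subseteq> [V]\<^bsup>2\<^esup>"

definition induced_edges :: "'v set set \<Rightarrow> 'v set \<Rightarrow> 'v set set" where
  "induced_edges E I = {e \<in> E. e \<subseteq> I}"

definition compl_edges :: "'v set \<Rightarrow> 'v set set \<Rightarrow> 'v set set" where
  "compl_edges V E = [V]\<^bsup>2\<^esup> - E"

definition cycle_edges :: "'v list \<Rightarrow> 'v set set" where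
  "cycle_edges vs = {{vs ! i, vs ! (Suc i mod length vs)} | i. i < length vs}"

text \<open>In \<open>hole\<close>, the inclusion of \<open>cycle_edges vs\<close> in \<open>E\<close> says that \<open>vs\<close> is a cycle, and the
  converse inclusion that it has no chord.\<close>

definition hole :: "'v set \<Rightarrow> 'v set set \<Rightarrow> bool" where
  "hole V E \<longleftrightarrow>
    (\<exists>vs. distinct vs \<and> length vs \<ge> 4 \<and> set vs = V \<and> E = cycle_edges vs)"

definition odd_hole :: "'v set \<Rightarrow> 'v set set \<Rightarrow> bool" where
  "odd_hole V E \<longleftrightarrow> hole V E \<and> odd (card V)"

definition odd_antihole :: "'v set \<Rightarrow> 'v set set \<Rightarrow> bool" where
  "odd_antihole V E \<longleftrightarrow> (\<exists>F. odd_hole V F \<and> E = compl_edges V F)"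

definition stable_sets :: "'v set \<Rightarrow> 'v set set \<Rightarrow> 'v set set" where
  "stable_sets V E = {S. S \<subseteq> V \<and> indep S E}"

text \<open>Vectors and matrices indexed by a vertex set \<open>V\<close> are represented by vectors and matrices
  indexed by the whole (finite) vertex type whose entries outside \<open>V\<close>, respectively
  \<open>V \<times> V\<close>, are 0. This holds automatically for all elements of the sets below.\<close>

definition incidence_vec :: "'v set \<Rightarrow> real ^ 'v" where
  "incidence_vec S = (\<chi> i. indicator S i)"

definition outer_square :: "real ^ 'v \<Rightarrow> real ^ 'v ^ 'v" where
  "outer_square s = (\<chi> i j. s $ i * s $ j)"

definition stable_vecs :: "'v set \<Rightarrow> 'v set set \<Rightarrow> (real ^ 'v) set" where
  "stable_vecs V E = incidence_vec ` stable_sets V E"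

definition stable_squares :: "'v set \<Rightarrow> 'v set set \<Rightarrow> (real ^ 'v ^ 'v) set" where
  "stable_squares V E = outer_square ` stable_vecs V E"

definition STAB2 :: "'v::finite set \<Rightarrow> 'v set set \<Rightarrow> (real ^ 'v ^ 'v) set" where
  "STAB2 V E = convex hull (stable_squares V E)"

end

theory Submission
  imports Defs
begin

text \<open>
  Both inequalities bound a linear functional of \<open>X\<close>, so it suffices to check them at the
  generators \<open>s s\<^sup>T\<close> of \<open>STAB2\<close>, where \<open>s\<close> is the incidence vector of a stable set \<open>S\<close>. At such a
  point, with \<open>t = \<bar>S \<inter> A\<bar>\<close>, they read \<open>t s\<^sub>k \<le> 2 s\<^sub>k\<close> and \<open>t + 2 s\<^sub>k \<le> 2 + t s\<^sub>k\<close>; the second is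
  \<open>(t - 2) (1 - s\<^sub>k) \<le> 0\<close>. As \<open>s\<^sub>k\<close> is 0 or 1, both follow from \<open>t \<le> 2\<close>.

  That bound is the stability number of an antihole: \<open>S \<inter> A\<close> is a clique in the complementary
  hole, and a cycle of length at least 4 contains no triangle
  (\<open>cycle_edges_triangle_free\<close>, \<open>card_stable_Int_antihole_le_2\<close>).
\<close>

lemma linear_le_on_convex_hull:
  fixes f :: "'a::real_vector \<Rightarrow> real"
  assumes "linear f" and "\<And>x. x \<in> S \<Longrightarrow> f x \<le> c" and "x \<in> convex hull S"
  shows "f x \<le> c"
proof -
  have "convex (f -` {..c})"
    using assms(1) by (intro convex_linear_vimage) auto
  then have "convex hull S \<subseteq> f -` {..c}"
    using assms(2) by (intro hull_minimal) auto
  then show ?thesis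
    using assms(3) by auto
qed

lemma cycle_edge_index_cases:
  assumes "distinct vs" and "i < j" and "j < length vs"
    and "{vs ! i, vs ! j} \<in> cycle_edges vs"
  shows "j = Suc i \<or> i = 0 \<and> Suc j = length vs"
proof -
  obtain m where m: "m < length vs"
    and eq: "{vs ! i, vs ! j} = {vs ! m, vs ! (Suc m mod length vs)}"
    using assms(4) by (auto simp: cycle_edges_def)
  have "Suc m mod length vs < length vs"
    using m by (intro mod_less_divisor) auto
  then have "i = m \<and> j = Suc m mod length vs \<or> i = Suc m mod length vs \<and> j = m"
    using eq assms(1-3) m by (auto simp: doubleton_eq_iff nth_eq_iff_index_eq)
  then show ?thesis
    using assms(2,3) m by (cases "Suc m = length vs") auto
qed

text \<open>Of the three pairs from \<open>i < j < l\<close>, only \<open>{i, l}\<close> can be the pair joined by the closing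
  edge of the cycle. The other two are consecutive, so \<open>l = i + 2\<close>, and closing up forces
  length 3.\<close>

lemma cycle_edges_triangle_free:
  assumes "distinct vs" and "length vs \<ge> 4" and "i < j" and "j < l" and "l < length vs"
    and "{vs ! i, vs ! j} \<in> cycle_edges vs" and "{vs ! j, vs ! l} \<in> cycle_edges vs"
    and "{vs ! i, vs ! l} \<in> cycle_edges vs"
  shows False
  using cycle_edge_index_cases[of vs i j] cycle_edge_index_cases[of vs j l]
    cycle_edge_index_cases[of vs i l] assms by auto

lemma card_gt_2_obtain_increasing:
  fixes J :: "'a::linorder set"
  assumes "finite J" and "card J > 2"
  obtains i j l where "i \<in> J" "j \<in> J" "l \<in> J" "i < j" "j < l"
proof -
  have ne: "J \<noteq> {}"
    using assms(2) by auto
  have "card {Min J, Max J} \<le> 2"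
    by (simp add: card_insert_if)
  then have "\<not> J \<subseteq> {Min J, Max J}"
    using assms(2) card_mono[of "{Min J, Max J}" J] by auto
  then obtain j where j: "j \<in> J" "j \<noteq> Min J" "j \<noteq> Max J"
    by auto
  have "Min J < j" and "j < Max J"
    using j assms(1) by (simp_all add: order.strict_iff_order)
  then show ?thesis
    using that[of "Min J" j "Max J"] j(1) assms(1) ne by simp
qed

lemma card_stable_Int_antihole_le_2:
  assumes "odd_antihole A (induced_edges E A)" and "indep S (induced_edges E B)" and "A \<subseteq> B"
  shows "card (S \<inter> A) \<le> 2"
proof (rule ccontr)
  assume large: "\<not> card (S \<inter> A) \<le> 2"
  obtain vs where vs: "distinct vs" "length vs \<ge> 4" "set vs = A"
    and antihole: "induced_edges E A = compl_edges A (cycle_edges vs)"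
    using assms(1) unfolding odd_antihole_def odd_hole_def hole_def by blast
  have clique: "{v, w} \<in> cycle_edges vs" if "v \<in> S \<inter> A" "w \<in> S \<inter> A" "v \<noteq> w" for v w
  proof -
    have "{v, w} \<notin> induced_edges E A"
      using that assms(2,3) by (auto simp: indep_def induced_edges_def)
    moreover have "{v, w} \<in> [A]\<^bsup>2\<^esup>"
      using that by (auto simp: nsets_def)
    ultimately show ?thesis
      unfolding antihole compl_edges_def by blast
  qed
  define J where "J = {i. i < length vs \<and> vs ! i \<in> S}"
  have "(!) vs ` J = S \<inter> A"
    using vs(3) by (auto simp: J_def in_set_conv_nth image_iff)
  moreover have finJ: "finite J"
    by (simp add: J_def)
  ultimately have "card J > 2"
    using large card_image_le[of J "(!) vs"] by simp
  then obtain i j l where J: "i \<in> J" "j \<in> J" "l \<in> J" and less: "i < j" "j < l"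
    using card_gt_2_obtain_increasing[OF finJ] by blast
  have edge: "{vs ! p, vs ! q} \<in> cycle_edges vs" if "p \<in> J" "q \<in> J" "p < q" for p q
    using that vs by (intro clique) (auto simp: J_def nth_eq_iff_index_eq)
  show False
    using cycle_edges_triangle_free[OF vs(1,2) less] edge J less
    by (auto simp: J_def)
qed

theorem lemma18:
  fixes V A :: "'v::finite set" and E :: "'v set set" and k :: 'v and X :: "real ^ 'v ^ 'v"
  assumes "simple_graph V E"
    and "A \<subseteq> V"
    and "odd_antihole A (induced_edges E A)"
    and "k \<in> V - A"
    and "X \<in> STAB2 (A \<union> {k}) (induced_edges E (A \<union> {k}))"
  shows "(\<Sum>i\<in>A. X $ i $ k) \<le> 2 * X $ k $ k \<and>
    (\<Sum>i\<in>A. X $ i $ i) + 2 * X $ k $ k \<le> 2 + (\<Sum>i\<in>A. X $ i $ k)"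
proof -
  let ?G = "stable_squares (A \<union> {k}) (induced_edges E (A \<union> {k}))"
  let ?f = "\<lambda>Y :: real ^ 'v ^ 'v. (\<Sum>i\<in>A. Y $ i $ k) - 2 * Y $ k $ k"
  let ?g = "\<lambda>Y :: real ^ 'v ^ 'v. (\<Sum>i\<in>A. Y $ i $ i) + 2 * Y $ k $ k - (\<Sum>i\<in>A. Y $ i $ k)"
  have lin: "linear ?f" "linear ?g"
    by (auto intro!: linearI simp: sum.distrib sum_distrib_left algebra_simps)
  have vertex: "?f Y \<le> 0 \<and> ?g Y \<le> 2" if Y_in: "Y \<in> ?G" for Y
  proof -
    obtain S where "indep S (induced_edges E (A \<union> {k}))"
      and Y: "Y = outer_square (incidence_vec S)"
      using Y_in unfolding stable_squares_def stable_vecs_def stable_sets_def by blast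
    then have le2: "card (S \<inter> A) \<le> 2"
      using card_stable_Int_antihole_le_2[OF assms(3)] by blast
    have entry: "Y $ i $ j = of_bool (i \<in> S \<and> j \<in> S)" for i j
      by (simp add: Y outer_square_def incidence_vec_def indicator_def)
    have "(\<Sum>i\<in>A. of_bool (i \<in> S)) = real (card (S \<inter> A))"
      by (simp add: Int_def conj_commute)
    then have "(\<Sum>i\<in>A. Y $ i $ i) = real (card (S \<inter> A))"
      and "(\<Sum>i\<in>A. Y $ i $ k) = (if k \<in> S then real (card (S \<inter> A)) else 0)"
      by (simp_all add: entry del: sum_of_bool_eq)
    then show ?thesis
      using le2 by (simp add: entry)
  qed
  have X: "X \<in> convex hull ?G"
    using assms(5) by (simp add: STAB2_def)
  have "?f X \<le> 0"
    using linear_le_on_convex_hull[OF lin(1) _ X] vertex by blast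
  moreover have "?g X \<le> 2"
    using linear_le_on_convex_hull[OF lin(2) _ X] vertex by blast
  ultimately show ?thesis
    by linarith
qed

end
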